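(* For every constant $K>1$ there is a constant $C_K$, depending only on $K$, with $0<C_K\le2$, such that for all positive integers $n$ and $p$ and all $\mu\in\mathbb{R}^p$ the following holds: if $X_1,\dots,X_{n+1}$ are i.i.d. with distribution $\mathcal{N}_p(\mu,\Sigma)$, then $$\inf_{\delta}\ \sup_{\Sigma\in\mathcal{D}_K}\ \mathbb{E}\left(\delta-\log\det\Sigma\right)^2\ \ge\ C_K\cdot\frac pn,$$ where the infimum is over all measurable estimators $\delta=\delta(X_1,\dots,X_{n+1})$.
   Context: For $K>1$, $\mathcal{D}_K=\{\mathrm{diag}(a,a,\dots,a): 1/K\le a\le K\}$ is the collection of $p\times p$ diagonal matrices with all diagonal entries equal to a common value $a\in[1/K,K]$. No relation between $p$ and $n$ is assumed (in particular $p>n$ is allowed). *)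

theory Defs
  imports "HOL-Probability.Probability"
    "Jordan_Normal_Form.Determinant"
    "Jordan_Normal_Form.Gauss_Jordan_Elimination"
begin

hide_const (open) Finite_Cartesian_Product.vec Determinants.det

text \<open>
  The dimension \<open>p\<close> varies inside the statements, so points of \<open>\<real>\<^sup>p\<close> are represented by extensional
  functions on \<open>{..<p}\<close>; this gives access to the product sigma-algebra.  The mean and the
  covariance are a vector and a matrix of dimension \<open>p\<close>.
\<close>

abbreviation borel_vec :: "nat \<Rightarrow> (nat \<Rightarrow> real) measure" where
  "borel_vec p \<equiv> PiM {..<p} (\<lambda>_. borel)"

abbreviation lborel_vec :: "nat \<Rightarrow> (nat \<Rightarrow> real) measure" where
  "lborel_vec p \<equiv> PiM {..<p} (\<lambda>_. lborel)"

definition mvn_density :: "nat \<Rightarrow> real vec \<Rightarrow> real mat \<Rightarrow> (nat \<Rightarrow> real) \<Rightarrow> real" where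
  "mvn_density p \<mu> \<Sigma> x =
     (let d = Matrix.vec p x - \<mu>
      in exp (- (d \<bullet> (the (mat_inverse \<Sigma>) *\<^sub>v d)) / 2) / sqrt ((2 * pi) ^ p * Determinant.det \<Sigma>))"

text \<open>
  The normal distribution with mean \<open>\<mu>\<close> and covariance \<open>\<Sigma>\<close>, given by its Lebesgue density.
  This is only meaningful for positive definite \<open>\<Sigma>\<close>; in particular, \<open>mat_inverse \<Sigma>\<close> is then not
  \<open>None\<close>.
\<close>

definition mvn :: "nat \<Rightarrow> real vec \<Rightarrow> real mat \<Rightarrow> (nat \<Rightarrow> real) measure" where
  "mvn p \<mu> \<Sigma> = density (lborel_vec p) (\<lambda>x. ennreal (mvn_density p \<mu> \<Sigma> x))"

text \<open>
  The joint law of i.i.d. observations \<open>X\<^sub>1, \<dots>, X\<^sub>m\<close> is the \<open>m\<close>-fold product measure; a point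
  \<open>x\<close> of the sample space has \<open>x i j\<close> as the \<open>j\<close>-th coordinate of the \<open>i\<close>-th observation.
\<close>

definition mvn_sample :: "nat \<Rightarrow> nat \<Rightarrow> real vec \<Rightarrow> real mat \<Rightarrow> (nat \<Rightarrow> nat \<Rightarrow> real) measure" where
  "mvn_sample m p \<mu> \<Sigma> = PiM {1..m} (\<lambda>_. mvn p \<mu> \<Sigma>)"

definition estimators :: "nat \<Rightarrow> nat \<Rightarrow> ((nat \<Rightarrow> nat \<Rightarrow> real) \<Rightarrow> real) set" where
  "estimators m p = borel_measurable (PiM {1..m} (\<lambda>_. borel_vec p))"

definition scalar_cov :: "real \<Rightarrow> nat \<Rightarrow> real mat set" where
  "scalar_cov K p = {mat_diag p (\<lambda>_. a) | a. 1 / K \<le> a \<and> a \<le> K}"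

text \<open>The risk takes values in \<open>[0, \<infinity>]\<close>, since the squared error need not be integrable.\<close>

definition log_det_risk ::
    "nat \<Rightarrow> nat \<Rightarrow> real vec \<Rightarrow> ((nat \<Rightarrow> nat \<Rightarrow> real) \<Rightarrow> real) \<Rightarrow> real mat \<Rightarrow> ennreal" where
  "log_det_risk m p \<mu> \<delta> \<Sigma> =
     (\<integral>\<^sup>+ x. ennreal ((\<delta> x - ln (Determinant.det \<Sigma>))\<^sup>2) \<partial>mvn_sample m p \<mu> \<Sigma>)"

end

theory Submission
  imports Defs
begin

text \<open>
  The bound is Le Cam's two-point argument.  The \<open>(n + 1) * p\<close> coordinates of the sample are
  independent normal variables with a common variance \<open>a\<close>, so \<open>ln a\<close> cannot be located more
  precisely than to order \<open>1 / sqrt ((n + 1) * p)\<close>.  The target \<open>ln (det \<Sigma>) = p * ln a\<close>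
  magnifies this error by \<open>p\<close>, which gives a squared error of order
  \<open>p\<^sup>2 / ((n + 1) * p)\<close>, that is, of order \<open>p / n\<close>.

  Concretely, the two variances are \<open>exp (- t)\<close> and \<open>exp t\<close>, where
  \<open>t = c / sqrt ((n + 1) * p)\<close> and \<open>c > 0\<close> is so small that both variances lie in
  \<open>[1 / K, K]\<close>.  The geometric mean of the two joint densities is \<open>r\<close> times the joint
  density with variance \<open>1 / cosh t\<close>, where \<open>r\<^sup>2 = (1 / cosh t) ^ ((n + 1) * p)\<close>
  (\<open>normal_density_mult_affinity\<close>, applied to each coordinate).  The number \<open>r\<close> is the
  Hellinger affinity of the two laws.  Since \<open>cosh t\<close> is \<open>1\<close> up to a term of order \<open>t\<^sup>2\<close>,
  and \<open>(n + 1) * p * t\<^sup>2 = c\<^sup>2\<close>, the affinity stays bounded away from zero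
  (\<open>inverse_cosh_power_ge\<close>).  By \<open>two_point_risk_ge\<close>, no estimator of a parameter can then have small
  risk under both laws: the two risks sum to at least \<open>r\<^sup>2 / 2\<close> times the squared distance
  \<open>(2 * t * p)\<^sup>2\<close> between the two parameter values.
\<close>

section \<open>Two hypotheses with a common dominating measure\<close>

text \<open>
  For fixed \<open>u - v\<close>, the smallest value of \<open>A * u\<^sup>2 + B * v\<^sup>2\<close> is
  \<open>A * B / (A + B) * (u - v)\<^sup>2\<close>.  The inequality between arithmetic and geometric means,
  \<open>2 * t * S \<le> S\<^sup>2 / (A + B) + t\<^sup>2 * (A + B)\<close>, trades this quotient for an expression that is
  linear in \<open>S = sqrt (A * B)\<close> and in \<open>A + B\<close>.  With densities for \<open>A\<close> and \<open>B\<close>, such an expression can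
  be integrated exactly.
\<close>

lemma weighted_square_losses_ge:
  fixes A B S t u v :: real
  assumes "0 \<le> A" "0 \<le> B" "A * B = S\<^sup>2"
  shows "2 * t * S * (u - v)\<^sup>2 \<le> A * u\<^sup>2 + B * v\<^sup>2 + t\<^sup>2 * (u - v)\<^sup>2 * (A + B)"
proof (cases "A + B = 0")
  case True
  with assms have "A = 0" "B = 0" by auto
  moreover from this assms(3) have "S = 0" by simp
  ultimately show ?thesis by simp
next
  case False
  with assms have pos: "0 < A + B" by auto
  have "(A + B) * (A * u\<^sup>2 + B * v\<^sup>2 + t\<^sup>2 * (u - v)\<^sup>2 * (A + B))
      = A * B * (u - v)\<^sup>2 + (A * u + B * v)\<^sup>2 + t\<^sup>2 * (u - v)\<^sup>2 * (A + B)\<^sup>2"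
    by (simp add: power2_eq_square algebra_simps)
  also have "\<dots> = (A + B) * (2 * t * S * (u - v)\<^sup>2) + (S - t * (A + B))\<^sup>2 * (u - v)\<^sup>2 + (A * u + B * v)\<^sup>2"
    unfolding assms(3) by (simp add: power2_eq_square algebra_simps)
  also have "\<dots> \<ge> (A + B) * (2 * t * S * (u - v)\<^sup>2)"
    by simp
  finally show ?thesis
    using pos by (simp only: mult_le_cancel_left_pos)
qed

text \<open>
  The function \<open>r * g\<close> is the geometric mean of the densities \<open>f0\<close> and \<open>f1\<close>, so its integral
  \<open>r\<close> is their Hellinger affinity.  Integrating \<open>weighted_square_losses_ge\<close> gives the lower bound
  \<open>(2 * t * r - 2 * t\<^sup>2) * (\<theta>0 - \<theta>1)\<^sup>2\<close> for every \<open>t\<close>, and \<open>t = r / 2\<close> is the best choice.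
\<close>

lemma two_point_risk_ge:
  fixes f0 f1 g \<delta> :: "'a \<Rightarrow> real" and r \<theta>0 \<theta>1 :: real
  assumes [measurable]: "f0 \<in> borel_measurable M" "f1 \<in> borel_measurable M"
      "g \<in> borel_measurable M" "\<delta> \<in> borel_measurable M"
    and nonneg: "\<And>x. 0 \<le> f0 x" "\<And>x. 0 \<le> f1 x" "\<And>x. 0 \<le> g x" "0 \<le> r"
    and total: "(\<integral>\<^sup>+x. ennreal (f0 x) \<partial>M) = 1" "(\<integral>\<^sup>+x. ennreal (f1 x) \<partial>M) = 1"
      "(\<integral>\<^sup>+x. ennreal (g x) \<partial>M) = 1"
    and affinity: "\<And>x. f0 x * f1 x = (r * g x)\<^sup>2"
  shows "ennreal (r\<^sup>2 * (\<theta>0 - \<theta>1)\<^sup>2 / 2) \<le>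
      (\<integral>\<^sup>+x. ennreal ((\<delta> x - \<theta>0)\<^sup>2) \<partial>density M (\<lambda>x. ennreal (f0 x))) +
      (\<integral>\<^sup>+x. ennreal ((\<delta> x - \<theta>1)\<^sup>2) \<partial>density M (\<lambda>x. ennreal (f1 x)))"
    (is "_ \<le> ?R0 + ?R1")
proof -
  define D where "D = (\<theta>0 - \<theta>1)\<^sup>2"
  have [simp]: "0 \<le> D" unfolding D_def by simp
  have pointwise: "ennreal (r\<^sup>2 * D) * ennreal (g x) \<le>
      ennreal (f0 x) * ennreal ((\<delta> x - \<theta>0)\<^sup>2) + ennreal (f1 x) * ennreal ((\<delta> x - \<theta>1)\<^sup>2)
      + ennreal (r\<^sup>2 * D / 4) * (ennreal (f0 x) + ennreal (f1 x))" for x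
  proof -
    have D: "(\<delta> x - \<theta>0 - (\<delta> x - \<theta>1))\<^sup>2 = D"
      by (simp add: D_def power2_commute)
    have "r\<^sup>2 * D * g x \<le>
        f0 x * (\<delta> x - \<theta>0)\<^sup>2 + f1 x * (\<delta> x - \<theta>1)\<^sup>2 + r\<^sup>2 * D / 4 * (f0 x + f1 x)"
      using weighted_square_losses_ge[OF nonneg(1,2) affinity,
          of "r / 2" x "\<delta> x - \<theta>0" "\<delta> x - \<theta>1"]
      unfolding D by (simp add: power_divide power2_eq_square[of r] mult_ac)
    then show ?thesis
      using nonneg by (simp flip: ennreal_mult ennreal_plus)
  qed
  have "ennreal (r\<^sup>2 * D) = (\<integral>\<^sup>+x. ennreal (r\<^sup>2 * D) * ennreal (g x) \<partial>M)"
    by (simp add: nn_integral_cmult total)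
  also have "\<dots> \<le> (\<integral>\<^sup>+x. ennreal (f0 x) * ennreal ((\<delta> x - \<theta>0)\<^sup>2)
      + ennreal (f1 x) * ennreal ((\<delta> x - \<theta>1)\<^sup>2)
      + ennreal (r\<^sup>2 * D / 4) * (ennreal (f0 x) + ennreal (f1 x)) \<partial>M)"
    by (intro nn_integral_mono pointwise)
  also have "\<dots> = ?R0 + ?R1 + ennreal (r\<^sup>2 * D / 4) * 2"
    by (simp add: nn_integral_add nn_integral_cmult nn_integral_density total)
  also have "ennreal (r\<^sup>2 * D / 4) * 2 = ennreal (r\<^sup>2 * D / 2)"
    by (simp flip: ennreal_numeral ennreal_mult)
  also have "ennreal (r\<^sup>2 * D) = ennreal (r\<^sup>2 * D / 2) + ennreal (r\<^sup>2 * D / 2)"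
    by (simp flip: ennreal_plus)
  finally show ?thesis
    by (simp add: D_def ennreal_add_left_cancel_le add.commute)
qed

section \<open>The Gaussian sample as a density\<close>

text \<open>
  On a box, the density and the indicator function both factor over the coordinates, so both
  measures give it the product of the one-dimensional integrals.
\<close>

lemma PiM_density:
  assumes "finite I" "product_sigma_finite M" "product_sigma_finite (\<lambda>i. density (M i) (f i))"
    and [measurable]: "\<And>i. i \<in> I \<Longrightarrow> f i \<in> borel_measurable (M i)"
  shows "PiM I (\<lambda>i. density (M i) (f i)) = density (PiM I M) (\<lambda>x. \<Prod>i\<in>I. f i (x i))"
proof -
  interpret M: product_sigma_finite M by fact
  interpret D: product_sigma_finite "\<lambda>i. density (M i) (f i)" by fact
  have [measurable]: "(\<lambda>x. \<Prod>i\<in>I. f i (x i)) \<in> borel_measurable (PiM I M)"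
    by (intro borel_measurable_prod_ennreal) measurable
  have "density (PiM I M) (\<lambda>x. \<Prod>i\<in>I. f i (x i)) = PiM I (\<lambda>i. density (M i) (f i))"
  proof (rule D.PiM_eqI[OF \<open>finite I\<close>])
    show "sets (density (PiM I M) (\<lambda>x. \<Prod>i\<in>I. f i (x i))) = PiM I (\<lambda>i. density (M i) (f i))"
      by (simp cong: sets_PiM_cong)
  next
    fix A assume "\<And>i. i \<in> I \<Longrightarrow> A i \<in> sets (density (M i) (f i))"
    then have A[measurable]: "\<And>i. i \<in> I \<Longrightarrow> A i \<in> sets (M i)" by simp
    have "emeasure (density (PiM I M) (\<lambda>x. \<Prod>i\<in>I. f i (x i))) (Pi\<^sub>E I A)
        = (\<integral>\<^sup>+x. (\<Prod>i\<in>I. f i (x i)) * indicator (Pi\<^sub>E I A) x \<partial>PiM I M)"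
      using A \<open>finite I\<close> by (intro emeasure_density) (auto intro!: sets_PiM_I_finite)
    also have "\<dots> = (\<integral>\<^sup>+x. (\<Prod>i\<in>I. f i (x i) * indicator (A i) (x i)) \<partial>PiM I M)"
    proof (intro nn_integral_cong)
      fix x assume "x \<in> space (PiM I M)"
      then have "indicator (Pi\<^sub>E I A) x = (\<Prod>i\<in>I. indicator (A i) (x i) :: ennreal)"
        using \<open>finite I\<close>
        by (auto simp: space_PiM indicator_def PiE_iff prod.neutral prod_zero_iff)
      then show "(\<Prod>i\<in>I. f i (x i)) * indicator (Pi\<^sub>E I A) x
          = (\<Prod>i\<in>I. f i (x i) * indicator (A i) (x i))"
        by (simp add: prod.distrib)
    qed
    also have "\<dots> = (\<Prod>i\<in>I. \<integral>\<^sup>+y. f i y * indicator (A i) y \<partial>M i)"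
      using \<open>finite I\<close> by (intro M.product_nn_integral_prod) measurable
    also have "\<dots> = (\<Prod>i\<in>I. emeasure (density (M i) (f i)) (A i))"
      by (intro prod.cong refl) (simp add: emeasure_density)
    finally show "emeasure (density (PiM I M) (\<lambda>x. \<Prod>i\<in>I. f i (x i))) (Pi\<^sub>E I A)
        = (\<Prod>i\<in>I. emeasure (density (M i) (f i)) (A i))" .
  qed
  then show ?thesis ..
qed

lemma det_mat_diag_const: "Determinant.det (mat_diag p (\<lambda>_. a)) = a ^ p"
proof -
  have "Determinant.det (mat_diag p (\<lambda>_. a)) = prod_list (diag_mat (mat_diag p (\<lambda>_. a)))"
    by (rule det_upper_triangular[where n = p]) (auto simp: mat_diag_def)
  also have "diag_mat (mat_diag p (\<lambda>_. a)) = replicate p a"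
    by (intro nth_equalityI) (auto simp: diag_mat_def mat_diag_def)
  finally show ?thesis by simp
qed

lemma mat_inverse_mat_diag_const:
  fixes a :: real
  assumes "a \<noteq> 0"
  shows "mat_inverse (mat_diag p (\<lambda>_. a)) = Some (mat_diag p (\<lambda>_. 1 / a))"
proof -
  let ?A = "mat_diag p (\<lambda>_. a)" and ?B = "mat_diag p (\<lambda>_. 1 / a)"
  have A: "?A \<in> carrier_mat p p" and B: "?B \<in> carrier_mat p p" by simp_all
  have AB: "?A * ?B = 1\<^sub>m p" "?B * ?A = 1\<^sub>m p" using assms by simp_all
  show ?thesis
  proof (cases "mat_inverse ?A")
    case None
    moreover have "?A \<in> Units (ring_mat TYPE(real) p ())"
      using A B assms by (auto simp: Units_def ring_mat_def intro!: bexI[of _ ?B])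
    ultimately show ?thesis using mat_inverse(1)[OF A None, where b = "()"] by blast
  next
    case (Some C)
    from mat_inverse(2)[OF A Some] have C: "?A * C = 1\<^sub>m p" "C \<in> carrier_mat p p" by auto
    have "C = ?B * ?A * C" using AB C by simp
    also have "\<dots> = ?B * (?A * C)" by (rule assoc_mult_mat[OF B A C(2)])
    also have "\<dots> = ?B" unfolding C(1) by (rule right_mult_one_mat[OF B])
    finally show ?thesis using Some by simp
  qed
qed

lemma mvn_density_mat_diag_const:
  fixes a :: real
  assumes "0 < a" "\<mu> \<in> carrier_vec p"
  shows "mvn_density p \<mu> (mat_diag p (\<lambda>_. a)) x = (\<Prod>j<p. normal_density (vec_index \<mu> j) (sqrt a) (x j))"
proof -
  define d where "d = Matrix.vec p x - \<mu>"
  have d: "d \<in> carrier_vec p" "\<And>j. j < p \<Longrightarrow> vec_index d j = x j - vec_index \<mu> j"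
    using assms unfolding d_def by auto
  have "mat_diag p (\<lambda>_. 1 / a) *\<^sub>v d = (1 / a) \<cdot>\<^sub>v d"
    using d(1) by (intro eq_vecI) (auto simp: mat_diag_def scalar_prod_def mult_delta_left)
  then have "d \<bullet> (mat_diag p (\<lambda>_. 1 / a) *\<^sub>v d) = (\<Sum>j<p. (x j - vec_index \<mu> j)\<^sup>2) / a"
    using d by (simp add: scalar_prod_def sum_divide_distrib power2_eq_square lessThan_atLeast0)
  moreover have "(\<Prod>j<p. normal_density (vec_index \<mu> j) (sqrt a) (x j))
      = exp (- ((\<Sum>j<p. (x j - vec_index \<mu> j)\<^sup>2) / a) / 2) / sqrt ((2 * pi) ^ p * a ^ p)"
    using assms
    by (simp add: normal_density_def prod_dividef exp_sum[symmetric] sum_negf sum_divide_distrib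
        real_sqrt_mult real_sqrt_power power_mult_distrib mult.commute)
  ultimately show ?thesis
    using assms(1)
    by (simp add: mvn_density_def mat_inverse_mat_diag_const det_mat_diag_const flip: d_def)
qed

text \<open>
  A scalar covariance makes all coordinates of all observations independent.  The function \<open>f\<close> integrates to one
  because \<open>mvn_sample\<close> is an iterated product of one-dimensional normal laws, hence a probability
  measure.
\<close>

lemma mvn_sample_mat_diag_const:
  fixes a :: real and m p :: nat
  assumes a: "0 < a" and \<mu>: "\<mu> \<in> carrier_vec p"
  defines "f \<equiv> \<lambda>x. \<Prod>i\<in>{1..m}. \<Prod>j<p. normal_density (vec_index \<mu> j) (sqrt a) (x i j)"
  shows "mvn_sample m p \<mu> (mat_diag p (\<lambda>_. a)) = density (PiM {1..m} (\<lambda>_. lborel_vec p)) (\<lambda>x. ennreal (f x))"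
    and "(\<integral>\<^sup>+x. ennreal (f x) \<partial>PiM {1..m} (\<lambda>_. lborel_vec p)) = 1"
proof -
  let ?N = "\<lambda>j. density lborel (\<lambda>y. ennreal (normal_density (vec_index \<mu> j) (sqrt a) y))"
  have prob: "prob_space (?N j)" for j
    using a by (intro prob_space_normal_density) simp
  have psf: "product_sigma_finite M" if "\<And>i. prob_space (M i)" for M :: "nat \<Rightarrow> 'b measure"
    using that by (auto intro!: product_sigma_finite.intro prob_space_imp_sigma_finite)
  have lb: "product_sigma_finite (\<lambda>_::nat. lborel :: real measure)"
    by (intro product_sigma_finite.intro) (rule sigma_finite_lborel)
  then have lbv: "product_sigma_finite (\<lambda>_::nat. lborel_vec p)"
    by (intro product_sigma_finite.intro product_sigma_finite.sigma_finite
        finite_lessThan sigma_finite_lborel)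
  define h where "h = (\<lambda>x. \<Prod>j<p. normal_density (vec_index \<mu> j) (sqrt a) (x j))"
  have h[measurable]: "h \<in> borel_measurable (lborel_vec p)"
    unfolding h_def by measurable
  have mvn_density: "mvn p \<mu> (mat_diag p (\<lambda>_. a)) = density (lborel_vec p) (\<lambda>x. ennreal (h x))"
    using mvn_density_mat_diag_const[OF a \<mu>] by (simp add: mvn_def h_def)
  have "mvn p \<mu> (mat_diag p (\<lambda>_. a)) = PiM {..<p} ?N"
    unfolding mvn_density h_def
    by (subst PiM_density[OF _ lb psf[OF prob]]) (auto simp: prod_ennreal)
  then have prob_mvn: "prob_space (mvn p \<mu> (mat_diag p (\<lambda>_. a)))"
    by (simp add: prob_space_PiM prob)
  show eq: "mvn_sample m p \<mu> (mat_diag p (\<lambda>_. a))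
      = density (PiM {1..m} (\<lambda>_. lborel_vec p)) (\<lambda>x. ennreal (f x))"
  proof -
    have "mvn_sample m p \<mu> (mat_diag p (\<lambda>_. a))
        = density (PiM {1..m} (\<lambda>_. lborel_vec p)) (\<lambda>x. \<Prod>i\<in>{1..m}. ennreal (h (x i)))"
      unfolding mvn_sample_def mvn_density
      by (rule PiM_density[OF _ lbv psf]) (use prob_mvn in \<open>simp_all add: mvn_density\<close>)
    then show ?thesis by (simp add: prod_ennreal f_def h_def prod_nonneg)
  qed
  have f[measurable]: "f \<in> borel_measurable (PiM {1..m} (\<lambda>_. lborel_vec p))"
    unfolding f_def using h unfolding h_def by measurable
  have "prob_space (mvn_sample m p \<mu> (mat_diag p (\<lambda>_. a)))"
    unfolding mvn_sample_def by (intro prob_space_PiM prob_mvn)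
  from prob_space.emeasure_space_1[OF this]
  show "(\<integral>\<^sup>+x. ennreal (f x) \<partial>PiM {1..m} (\<lambda>_. lborel_vec p)) = 1"
    unfolding eq by (subst (asm) emeasure_density) (auto simp del: One_nat_def cong: nn_integral_cong_simp)
qed

section \<open>The affinity of two Gaussian samples\<close>

text \<open>
  In a product of normal densities with a common mean the precisions add up.  The precisions
  \<open>exp t\<close> and \<open>exp (- t)\<close> have the arithmetic mean \<open>cosh t\<close>, so the geometric mean of the two densities
  is proportional to the normal density with variance \<open>1 / cosh t\<close>.  Since the two variances multiply to
  one, the normalising constants leave only the factor \<open>1 / cosh t\<close>.
\<close>

lemma normal_density_mult_affinity:
  fixes t :: real
  shows "normal_density \<mu> (sqrt (exp (- t))) x * normal_density \<mu> (sqrt (exp t)) x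
    = 1 / cosh t * (normal_density \<mu> (sqrt (1 / cosh t)) x)\<^sup>2"
proof -
  have c: "0 < cosh t" by simp
  have "normal_density \<mu> (sqrt (exp (- t))) x * normal_density \<mu> (sqrt (exp t)) x
      = 1 / (sqrt (2 * pi * exp (- t)) * sqrt (2 * pi * exp t))
        * (exp (-(x - \<mu>)\<^sup>2 / (2 * exp (- t))) * exp (-(x - \<mu>)\<^sup>2 / (2 * exp t)))"
    by (simp add: normal_density_def)
  also have "sqrt (2 * pi * exp (- t)) * sqrt (2 * pi * exp t) = 2 * pi"
  proof -
    have "2 * pi * exp (- t) * (2 * pi * exp t) = (2 * pi)\<^sup>2"
      by (simp add: exp_minus power2_eq_square)
    then show ?thesis by (simp only: real_sqrt_mult[symmetric] real_sqrt_abs) simp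
  qed
  also have "exp (-(x - \<mu>)\<^sup>2 / (2 * exp (- t))) * exp (-(x - \<mu>)\<^sup>2 / (2 * exp t))
      = exp (-((x - \<mu>)\<^sup>2 * cosh t))"
    by (simp add: exp_add[symmetric] cosh_def exp_minus field_simps)
  finally have lhs: "normal_density \<mu> (sqrt (exp (- t))) x * normal_density \<mu> (sqrt (exp t)) x
      = 1 / (2 * pi) * exp (-((x - \<mu>)\<^sup>2 * cosh t))" .
  have "(normal_density \<mu> (sqrt (1 / cosh t)) x)\<^sup>2
      = 1 / (2 * pi * (1 / cosh t)) * (exp (-(x - \<mu>)\<^sup>2 / (2 * (1 / cosh t))))\<^sup>2"
    using c by (simp add: normal_density_def power_mult_distrib power_divide)
  also have "(exp (-(x - \<mu>)\<^sup>2 / (2 * (1 / cosh t))))\<^sup>2 = exp (-((x - \<mu>)\<^sup>2 * cosh t))"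
    by (simp add: exp_double[symmetric])
  finally show ?thesis
    unfolding lhs using c by (simp add: field_simps)
qed

lemma cosh_le_one_plus_square:
  fixes t :: real
  assumes "0 \<le> t" "t \<le> 1"
  shows "cosh t \<le> 1 + t\<^sup>2"
proof -
  have "exp (- t) \<le> 1 / (1 + t)"
    using exp_ge_add_one_self[of t] assms by (simp add: exp_minus field_simps)
  also have "1 / (1 + t) \<le> 1 - t + t\<^sup>2"
  proof -
    have "(1 - t + t\<^sup>2) * (1 + t) = 1 + t ^ 3"
      by (simp add: algebra_simps power2_eq_square power3_eq_cube)
    then show ?thesis using assms by (simp add: pos_divide_le_eq)
  qed
  finally have "exp (- t) \<le> 1 - t + t\<^sup>2" .
  with exp_bound[OF assms] show ?thesis
    by (simp add: cosh_def)
qed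

text \<open>
  The left-hand side depends on \<open>N\<close> and \<open>t\<close> only through \<open>N * t\<^sup>2\<close>.  So the affinity of two samples with
  \<open>N\<close> coordinates is bounded below uniformly in \<open>N\<close> when \<open>t\<close> is of order \<open>1 / sqrt N\<close>.
\<close>

lemma inverse_cosh_power_ge:
  fixes t :: real
  assumes "0 \<le> t" "t \<le> 1"
  shows "1 - real N * t\<^sup>2 \<le> (1 / cosh t) ^ N"
proof -
  have t2: "t\<^sup>2 \<le> 1" using assms by (simp add: power_le_one)
  have "1 - real N * t\<^sup>2 \<le> (1 - t\<^sup>2) ^ N"
    using Bernoulli_inequality[of "- t\<^sup>2" N] t2 by simp
  also have "\<dots> \<le> (1 / cosh t) ^ N"
  proof (rule power_mono)
    have "(1 - t\<^sup>2) * cosh t \<le> (1 - t\<^sup>2) * (1 + t\<^sup>2)"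
      using t2 cosh_le_one_plus_square[OF assms] by (intro mult_left_mono) auto
    also have "\<dots> \<le> 1" by (simp add: algebra_simps)
    finally show "1 - t\<^sup>2 \<le> 1 / cosh t" by (simp add: pos_le_divide_eq)
  qed (use t2 in simp)
  finally show ?thesis .
qed

section \<open>The minimax lower bound\<close>

lemma log_det_risk_two_point:
  fixes t :: real
  assumes "0 \<le> t" and \<mu>: "\<mu> \<in> carrier_vec p" and \<delta>: "\<delta> \<in> estimators m p"
  shows "ennreal (2 * (1 / cosh t) ^ (m * p) * (t * real p)\<^sup>2) \<le>
    log_det_risk m p \<mu> \<delta> (mat_diag p (\<lambda>_. exp (- t))) + log_det_risk m p \<mu> \<delta> (mat_diag p (\<lambda>_. exp t))"
proof -
  let ?M = "PiM {1..m} (\<lambda>_. lborel_vec p)"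
  define f where "f = (\<lambda>a x. \<Prod>i\<in>{1..m}. \<Prod>j<p. normal_density (vec_index \<mu> j) (sqrt a) (x i j))"
  have [measurable]: "f a \<in> borel_measurable ?M" for a
    unfolding f_def
    by (intro borel_measurable_prod measurable_compose[OF _ borel_measurable_normal_density]
        measurable_compose[OF measurable_component_singleton])
      (auto intro!: measurable_component_singleton[of _ "{..<p}" "\<lambda>_. lborel", simplified])
  have "sets ?M = sets (PiM {1..m} (\<lambda>_. borel_vec p))"
    by (intro sets_PiM_cong) auto
  then have [measurable]: "\<delta> \<in> borel_measurable ?M"
    using \<delta> unfolding estimators_def by (simp cong: measurable_cong_sets)
  have nonneg: "0 \<le> f a x" for a x
    unfolding f_def by (intro prod_nonneg) simp
  define r where "r = sqrt ((1 / cosh t) ^ (m * p))"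
  have r: "0 \<le> r" "r\<^sup>2 = (1 / cosh t) ^ (m * p)" unfolding r_def by simp_all
  have affinity: "f (exp (- t)) x * f (exp t) x = (r * f (1 / cosh t) x)\<^sup>2" for x
  proof -
    have "f (exp (- t)) x * f (exp t) x
        = (\<Prod>i\<in>{1..m}. \<Prod>j<p. 1 / cosh t * (normal_density (vec_index \<mu> j) (sqrt (1 / cosh t)) (x i j))\<^sup>2)"
      unfolding f_def prod.distrib[symmetric] normal_density_mult_affinity ..
    also have "\<dots> = ((1 / cosh t) ^ p) ^ m * (f (1 / cosh t) x)\<^sup>2"
      unfolding f_def prod.distrib prod_power_distrib prod_constant by simp
    finally show ?thesis
      by (simp only: power_mult_distrib r(2) power_mult[symmetric] mult.commute[of p m])
  qed
  have risk: "log_det_risk m p \<mu> \<delta> (mat_diag p (\<lambda>_. exp s))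
      = (\<integral>\<^sup>+x. ennreal ((\<delta> x - real p * s)\<^sup>2) \<partial>density ?M (\<lambda>x. ennreal (f (exp s) x)))" for s
    unfolding log_det_risk_def det_mat_diag_const f_def
      mvn_sample_mat_diag_const(1)[OF exp_gt_zero \<mu>]
    by (simp add: ln_realpow)
  have total: "(\<integral>\<^sup>+x. ennreal (f a x) \<partial>?M) = 1" if "0 < a" for a
    unfolding f_def using that \<mu> by (rule mvn_sample_mat_diag_const(2))
  have "ennreal (r\<^sup>2 * (real p * - t - real p * t)\<^sup>2 / 2) \<le>
      log_det_risk m p \<mu> \<delta> (mat_diag p (\<lambda>_. exp (- t))) + log_det_risk m p \<mu> \<delta> (mat_diag p (\<lambda>_. exp t))"
    unfolding risk
    by (rule two_point_risk_ge[where g = "f (1 / cosh t)"])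
      (use nonneg r(1) in \<open>simp_all add: total affinity del: One_nat_def\<close>)
  also have "r\<^sup>2 * (real p * - t - real p * t)\<^sup>2 / 2 = 2 * (1 / cosh t) ^ (m * p) * (t * real p)\<^sup>2"
    unfolding r(2) by (simp add: power2_eq_square algebra_simps)
  finally show ?thesis .
qed

theorem theorem5:
  fixes K :: real
  assumes "K > 1"
  shows "\<exists>C::real. 0 < C \<and> C \<le> 2 \<and>
    (\<forall>(n::nat) (p::nat). \<forall>\<mu> \<in> carrier_vec p. n \<ge> 1 \<longrightarrow> p \<ge> 1 \<longrightarrow>
      (INF \<delta> \<in> estimators (n + 1) p. SUP \<Sigma> \<in> scalar_cov K p. log_det_risk (n + 1) p \<mu> \<delta> \<Sigma>)
        \<ge> ennreal (C * (real p / real n)))"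
proof -
  define c where "c = min (1 / 2) (ln K)"
  (* c <= ln K keeps both hypotheses in scalar_cov K p; c <= 1 / 2 makes the squared affinity
     at least 1 - c^2 >= 3 / 4. *)
  have c: "0 < c" "c \<le> 1 / 2" "c \<le> ln K" using assms unfolding c_def by auto
  have c2: "c\<^sup>2 \<le> 1 / 4" using power_mono[OF c(2), of 2] c(1) by (simp add: power2_eq_square)
  have bound: "ennreal (c\<^sup>2 / 4 * (real p / real n)) \<le>
      (SUP \<Sigma> \<in> scalar_cov K p. log_det_risk (n + 1) p \<mu> \<delta> \<Sigma>)"
    if \<mu>: "\<mu> \<in> carrier_vec p" and n: "n \<ge> 1" and p: "p \<ge> 1" and \<delta>: "\<delta> \<in> estimators (n + 1) p"
    for n p \<mu> \<delta>
  proof -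
    define t where "t = c / sqrt (real ((n + 1) * p))"
    have N: "1 \<le> real ((n + 1) * p)" using n p by (simp del: of_nat_mult of_nat_add)
    then have t: "0 \<le> t" "t \<le> c" unfolding t_def using c(1) by (auto simp: divide_le_eq)
    have t2: "real ((n + 1) * p) * t\<^sup>2 = c\<^sup>2" unfolding t_def using N by (simp add: power_divide)
    have "t \<le> ln K" "t \<le> 1" using t c by auto
    then have "exp t \<le> K" "1 / K \<le> exp (- t)"
      using assms by (auto simp: ln_ge_iff exp_minus inverse_eq_divide intro!: divide_left_mono)
    moreover have "1 / K \<le> exp t" "exp (- t) \<le> K"
      using assms t(1) calculation exp_le_cancel_iff[of "- t" t] by linarith+
    ultimately have mem: "mat_diag p (\<lambda>_. exp (- t)) \<in> scalar_cov K p"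
        "mat_diag p (\<lambda>_. exp t) \<in> scalar_cov K p"
      unfolding scalar_cov_def by auto
    (* There are n + 1 observations; passing from n + 1 to n costs a factor 2, because n >= 1. *)
    have "c\<^sup>2 / 2 * (real p / real n) \<le> 3 / 2 * c\<^sup>2 * (real p / real (n + 1))"
    proof -
      have "real p / real n \<le> 2 * (real p / real (n + 1))"
        using n mult_right_mono[of 1 "real n" "real p"] by (simp add: field_simps)
      from mult_left_mono[OF this, of "c\<^sup>2 / 2"]
      have "c\<^sup>2 / 2 * (real p / real n) \<le> c\<^sup>2 * (real p / real (n + 1))" by simp
      also have "\<dots> \<le> 3 / 2 * c\<^sup>2 * (real p / real (n + 1))" by (intro mult_right_mono) auto
      finally show ?thesis .
    qed
    also have "\<dots> = 2 * (3 / 4) * (t * real p)\<^sup>2"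
      unfolding t2[symmetric] by (simp add: power2_eq_square field_simps)
    also have "\<dots> \<le> 2 * (1 / cosh t) ^ ((n + 1) * p) * (t * real p)\<^sup>2"
      using inverse_cosh_power_ge[OF t(1) \<open>t \<le> 1\<close>, of "(n + 1) * p"] c2 unfolding t2
      by (intro mult_right_mono) auto
    finally have "ennreal (c\<^sup>2 / 2 * (real p / real n)) \<le>
        ennreal (2 * (1 / cosh t) ^ ((n + 1) * p) * (t * real p)\<^sup>2)"
      by (rule ennreal_leI)
    also note log_det_risk_two_point[OF t(1) \<mu> \<delta>]
    (* The supremum is at least the average of the two risks. *)
    also have "log_det_risk (n + 1) p \<mu> \<delta> (mat_diag p (\<lambda>_. exp (- t)))
        + log_det_risk (n + 1) p \<mu> \<delta> (mat_diag p (\<lambda>_. exp t))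
        \<le> 2 * (SUP \<Sigma> \<in> scalar_cov K p. log_det_risk (n + 1) p \<mu> \<delta> \<Sigma>)"
      unfolding mult_2 by (intro add_mono SUP_upper mem)
    also have "ennreal (c\<^sup>2 / 2 * (real p / real n)) = 2 * ennreal (c\<^sup>2 / 4 * (real p / real n))"
      by (simp flip: ennreal_numeral ennreal_mult)
    finally show ?thesis
      by (simp add: ennreal_mult_le_mult_iff)
  qed
  show ?thesis
  proof (intro exI[of _ "c\<^sup>2 / 4"] conjI allI ballI impI)
    show "0 < c\<^sup>2 / 4" "c\<^sup>2 / 4 \<le> 2" using c c2 by auto
  qed (rule INF_greatest, rule bound)
qed

end
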